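(* Let $(L,\leq,0,1)$ be a bounded lattice with $e\in L\setminus\{0,1\}$, let $T_e$ be a $t$-norm on $[0,e]$ and let $S_e$ be a $t$-conorm on $[e,1]$. (i) Suppose $x\parallel y$ for all $x\in I_e$ and $y\in[e,1[$. Then the function $U_1:L^2\to L$ defined by $$U_1(x,y)=\begin{cases} T_e(x,y) & \text{if }(x,y)\in[0,e]^2,\\ S_e(x,y) & \text{if }(x,y)\in[e,1]^2,\\ x & \text{if }(x,y)\in I_e\times[e,1[\,\cup\, I_e\times[0,e[,\\ y & \text{if }(x,y)\in[e,1[\,\times I_e\cup[0,e[\,\times I_e,\\ x\vee y & \text{if }(x,y)\in I_e^2\cup I_e\times\{1\}\cup\{1\}\times I_e\cup[0,e[\,\times\{1\}\cup\{1\}\times[0,e[,\\ x\wedge y & \text{otherwise}\end{cases}$$ is a uninorm on $L$ with neutral element $e$ if and only if $S_e(x,y)<1$ for all $x,y<1$ (with $x,y\in[e,1]$). (ii) Suppose $x\parallel y$ for all $x\in I_e$ and $y\in\,]0,e]$. Then the function $U_2:L^2\to L$ defined by $$U_2(x,y)=\begin{cases} T_e(x,y) & \text{if }(x,y)\in[0,e]^2,\\ S_e(x,y) & \text{if }(x,y)\in[e,1]^2,\\ x & \text{if }(x,y)\in I_e\times\,]e,1]\cup I_e\times\,]0,e],\\ y & \text{if }(x,y)\in\,]e,1]\times I_e\cup\,]0,e]\times I_e,\\ x\wedge y & \text{if }(x,y)\in I_e^2\cup I_e\times\{0\}\cup\{0\}\times I_e\cup\,]e,1]\times\{0\}\cup\{0\}\times\,]e,1],\\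 x\vee y & \text{otherwise}\end{cases}$$ is a uninorm on $L$ with neutral element $e$ if and only if $T_e(x,y)>0$ for all $x,y>0$ (with $x,y\in[0,e]$).
   Context: A bounded lattice $(L,\leq,0,1)$ is a lattice with bottom element $0$ and top element $1$. For $a\le b$ in $L$: $[a,b]=\{x\in L: a\le x\le b\}$, $[a,b[\,=\{x: a\le x<b\}$, $]a,b]=\{x: a<x\le b\}$, $]a,b[\,=\{x: a<x<b\}$. Write $x\parallel y$ if $x$ and $y$ are incomparable, and $I_e=\{x\in L: x\parallel e\}$. A $t$-norm (resp. $t$-conorm) on a bounded lattice is a binary operation on it that is commutative, associative, increasing in both variables, and has the top (resp. bottom) element of that lattice as neutral element; so a $t$-norm on $[0,e]$ has neutral element $e$, and a $t$-conorm on $[e,1]$ has neutral element $e$. A uninorm on $L$ with neutral element $e\in L$ is a map $U:L^2\to L$ that is commutative, associative, increasing in both variables, and satisfies $U(e,x)=x$ for all $x\in L$. *)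

theory Defs
  imports Main
begin

definition incomparable :: "'a::order \<Rightarrow> 'a \<Rightarrow> bool" where
  "incomparable x y \<longleftrightarrow> \<not> x \<le> y \<and> \<not> y \<le> x"

definition incomparables :: "'a::order \<Rightarrow> 'a set" where
  "incomparables e = {x. incomparable x e}"

text \<open>The axioms shared by t-norms, t-conorms and uninorms. Operations are total functions on
  the type; on a proper subset \<open>A\<close> only the values on \<open>A \<times> A\<close> are constrained.\<close>

definition comm_assoc_increasing_on :: "'a::order set \<Rightarrow> ('a \<Rightarrow> 'a \<Rightarrow> 'a) \<Rightarrow> bool" where
  "comm_assoc_increasing_on A F \<longleftrightarrow>
     (\<forall>x\<in>A. \<forall>y\<in>A. F x y \<in> A) \<and>
     (\<forall>x\<in>A. \<forall>y\<in>A. F x y = F y x) \<and>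
     (\<forall>x\<in>A. \<forall>y\<in>A. \<forall>z\<in>A. F (F x y) z = F x (F y z)) \<and>
     (\<forall>x\<in>A. \<forall>x'\<in>A. \<forall>y\<in>A. x \<le> x' \<longrightarrow> F x y \<le> F x' y) \<and>
     (\<forall>x\<in>A. \<forall>y\<in>A. \<forall>y'\<in>A. y \<le> y' \<longrightarrow> F x y \<le> F x y')"

text \<open>The bounded lattices carrying t-norms and t-conorms here are the intervals
  \<open>{a..b}\<close>, whose bottom is \<open>a\<close> and whose top is \<open>b\<close>.\<close>

definition tnorm_on :: "'a::lattice \<Rightarrow> 'a \<Rightarrow> ('a \<Rightarrow> 'a \<Rightarrow> 'a) \<Rightarrow> bool" where
  "tnorm_on a b T \<longleftrightarrow>
     comm_assoc_increasing_on {a..b} T \<and> (\<forall>x\<in>{a..b}. T b x = x)"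

definition tconorm_on :: "'a::lattice \<Rightarrow> 'a \<Rightarrow> ('a \<Rightarrow> 'a \<Rightarrow> 'a) \<Rightarrow> bool" where
  "tconorm_on a b S \<longleftrightarrow>
     comm_assoc_increasing_on {a..b} S \<and> (\<forall>x\<in>{a..b}. S a x = x)"

definition uninorm :: "'a::bounded_lattice \<Rightarrow> ('a \<Rightarrow> 'a \<Rightarrow> 'a) \<Rightarrow> bool" where
  "uninorm e U \<longleftrightarrow> comm_assoc_increasing_on UNIV U \<and> (\<forall>x. U e x = x)"

text \<open>In both case distinctions the regions are disjoint, except that the first two meet in
  \<open>(e, e)\<close>, where a t-norm on \<open>{bot..e}\<close> and a t-conorm on \<open>{e..top}\<close> both take the value
  \<open>e\<close>. So the order of the tests is immaterial.\<close>

definition U1 ::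
  "'a::bounded_lattice \<Rightarrow> ('a \<Rightarrow> 'a \<Rightarrow> 'a) \<Rightarrow> ('a \<Rightarrow> 'a \<Rightarrow> 'a) \<Rightarrow> 'a \<Rightarrow> 'a \<Rightarrow> 'a" where
  "U1 e T S x y =
     (let I = incomparables e in
      if (x, y) \<in> {bot..e} \<times> {bot..e} then T x y
      else if (x, y) \<in> {e..top} \<times> {e..top} then S x y
      else if (x, y) \<in> I \<times> {e..<top} \<union> I \<times> {bot..<e} then x
      else if (x, y) \<in> {e..<top} \<times> I \<union> {bot..<e} \<times> I then y
      else if (x, y) \<in> I \<times> I \<union> I \<times> {top} \<union> {top} \<times> I
                       \<union> {bot..<e} \<times> {top} \<union> {top} \<times> {bot..<e} then sup x y
      else inf x y)"

definition U2 ::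
  "'a::bounded_lattice \<Rightarrow> ('a \<Rightarrow> 'a \<Rightarrow> 'a) \<Rightarrow> ('a \<Rightarrow> 'a \<Rightarrow> 'a) \<Rightarrow> 'a \<Rightarrow> 'a \<Rightarrow> 'a" where
  "U2 e T S x y =
     (let I = incomparables e in
      if (x, y) \<in> {bot..e} \<times> {bot..e} then T x y
      else if (x, y) \<in> {e..top} \<times> {e..top} then S x y
      else if (x, y) \<in> I \<times> {e<..top} \<union> I \<times> {bot<..e} then x
      else if (x, y) \<in> {e<..top} \<times> I \<union> {bot<..e} \<times> I then y
      else if (x, y) \<in> I \<times> I \<union> I \<times> {bot} \<union> {bot} \<times> I
                       \<union> {e<..top} \<times> {bot} \<union> {bot} \<times> {e<..top} then inf x y
      else sup x y)"

end

theory Submission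
  imports Defs "HOL-Library.Dual_Ordered_Lattice"
begin

text \<open>
  Split \<open>L\<close> into \<open>A = [0,e[\<close>, \<open>B = [e,1[\<close>, \<open>I\<^sub>e\<close> and \<open>{1}\<close>. If \<open>S\<close> maps \<open>B \<times> B\<close> into \<open>B\<close>, then
  \<open>U\<^sub>1\<close> is essentially an ordinal sum: it is \<open>S\<close> on \<open>B\<close>, \<open>T\<close> on \<open>A\<close> and the join on
  \<open>I\<^sub>e\<close>, and on a mixed pair the argument from the later of \<open>B\<close>, \<open>A\<close>, \<open>I\<^sub>e\<close>, \<open>{1}\<close> wins.
  The hypothesis on \<open>I\<^sub>e\<close> keeps joins of its elements in \<open>I\<^sub>e \<union> {1}\<close> and leaves no element of
  \<open>I\<^sub>e\<close> below one of \<open>B\<close>. Conversely, if \<open>S x y = 1\<close> with \<open>x, y \<in> B\<close>, associativity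
  fails at \<open>(x, y, 0)\<close>. Part (ii) is part (i) in the dual lattice, with \<open>T\<close> and \<open>S\<close>
  exchanged.
\<close>

text \<open>A locale, so that it can be interpreted again at \<open>dual e\<close> with the two
  operations exchanged; this is how part (ii) is reached.\<close>

locale norm_pair =
  fixes e :: "'a::bounded_lattice"
    and T S :: "'a \<Rightarrow> 'a \<Rightarrow> 'a"
  assumes e_bot: "e \<noteq> bot" and e_top: "e \<noteq> top"
    and tnorm: "tnorm_on bot e T"
    and tconorm: "tconorm_on e top S"
begin

abbreviation "U \<equiv> U1 e T S"
abbreviation "I \<equiv> incomparables e"

lemma T_closed: "x \<le> e \<Longrightarrow> y \<le> e \<Longrightarrow> T x y \<le> e"
  and T_comm: "x \<le> e \<Longrightarrow> y \<le> e \<Longrightarrow> T x y = T y x"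
  and T_assoc: "x \<le> e \<Longrightarrow> y \<le> e \<Longrightarrow> z \<le> e \<Longrightarrow> T (T x y) z = T x (T y z)"
  and T_mono: "x' \<le> e \<Longrightarrow> y \<le> e \<Longrightarrow> x \<le> x' \<Longrightarrow> T x y \<le> T x' y"
  and T_e: "x \<le> e \<Longrightarrow> T e x = x"
  using tnorm unfolding tnorm_on_def comm_assoc_increasing_on_def
  by (auto dest: order_trans)

lemma S_closed: "e \<le> x \<Longrightarrow> e \<le> y \<Longrightarrow> e \<le> S x y"
  and S_comm: "e \<le> x \<Longrightarrow> e \<le> y \<Longrightarrow> S x y = S y x"
  and S_assoc: "e \<le> x \<Longrightarrow> e \<le> y \<Longrightarrow> e \<le> z \<Longrightarrow> S (S x y) z = S x (S y z)"
  and S_mono: "e \<le> x \<Longrightarrow> e \<le> y \<Longrightarrow> x \<le> x' \<Longrightarrow> S x y \<le> S x' y"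
  and S_e: "e \<le> x \<Longrightarrow> S e x = x"
  using tconorm unfolding tconorm_on_def comm_assoc_increasing_on_def
  by (auto dest: order_trans)

text \<open>Raise the other argument to the neutral element \<open>e\<close>, the top of
  \<open>[0,e]\<close>.\<close>

lemma T_le: "x \<le> e \<Longrightarrow> y \<le> e \<Longrightarrow> T x y \<le> x" "x \<le> e \<Longrightarrow> y \<le> e \<Longrightarrow> T x y \<le> y"
  using T_mono[of e x y] T_mono[of e y x] by (simp_all add: T_e T_comm)

lemma S_ge: "e \<le> x \<Longrightarrow> e \<le> y \<Longrightarrow> x \<le> S x y" "e \<le> x \<Longrightarrow> e \<le> y \<Longrightarrow> y \<le> S x y"
  using S_mono[of e x y] S_mono[of e y x] by (simp_all add: S_e S_comm)

lemma T_less: "x < e \<Longrightarrow> y \<le> e \<Longrightarrow> T x y < e"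
  using T_le(1)[of x y] by (meson order_le_less_trans less_imp_le)

lemma S_top: "e \<le> x \<Longrightarrow> S x top = top" "e \<le> x \<Longrightarrow> S top x = top"
  using S_ge[of x top] S_ge[of top x] by (simp_all add: top_unique)

lemma region_cases [case_names below above incomparable top]:
  obtains "x < e" | "e \<le> x" "x < top" | "x \<in> I" | "x = top"
  by (auto simp: incomparables_def incomparable_def less_le)

lemma I_iff: "x \<in> I \<longleftrightarrow> \<not> x \<le> e \<and> \<not> e \<le> x"
  by (simp add: incomparables_def incomparable_def)

text \<open>A table of \<open>U\<close> by region, with \<open>top\<close> absorbing; the case
  analyses for part (i) rest on it alone.\<close>

lemma U1_simps:
  "x < e \<Longrightarrow> y < e \<Longrightarrow> U x y = T x y"
  "e \<le> x \<Longrightarrow> e \<le> y \<Longrightarrow> U x y = S x y"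
  "x < e \<Longrightarrow> e \<le> y \<Longrightarrow> y < top \<Longrightarrow> U x y = x"
  "e \<le> x \<Longrightarrow> x < top \<Longrightarrow> y < e \<Longrightarrow> U x y = y"
  "x \<in> I \<Longrightarrow> y \<in> I \<Longrightarrow> U x y = sup x y"
  "x \<in> I \<Longrightarrow> y < e \<Longrightarrow> U x y = x"
  "x \<in> I \<Longrightarrow> e \<le> y \<Longrightarrow> y < top \<Longrightarrow> U x y = x"
  "x < e \<Longrightarrow> y \<in> I \<Longrightarrow> U x y = y"
  "e \<le> x \<Longrightarrow> x < top \<Longrightarrow> y \<in> I \<Longrightarrow> U x y = y"
  "U x top = top"
  "U top x = top"
proof -
  show "x < e \<Longrightarrow> y < e \<Longrightarrow> U x y = T x y"
    by (simp add: U1_def Let_def less_imp_le)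
  show "U x y = S x y" if "e \<le> x" "e \<le> y"
    using that T_e[of e] S_e[of e] by (auto simp: U1_def Let_def dest: antisym)
  \<comment> \<open>For \<open>y = e\<close> the value comes from \<open>T\<close> and its neutral
    element; for \<open>y > e\<close> it is the final branch, a meet with \<open>x\<close> below
    \<open>y\<close>.\<close>
  have "U x y = x \<and> U y x = x" if "x < e" "e \<le> y" "y < top" for x y
    using that T_e[of x] T_comm[of x e]
    by (auto simp: U1_def Let_def I_iff less_le intro: antisym inf_absorb1 inf_absorb2 order_trans)
  then show "x < e \<Longrightarrow> e \<le> y \<Longrightarrow> y < top \<Longrightarrow> U x y = x"
    "e \<le> x \<Longrightarrow> x < top \<Longrightarrow> y < e \<Longrightarrow> U x y = y"
    by simp_all
  show "x \<in> I \<Longrightarrow> y \<in> I \<Longrightarrow> U x y = sup x y"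
    by (auto simp: U1_def Let_def I_iff)
  show "x \<in> I \<Longrightarrow> y < e \<Longrightarrow> U x y = x" "x \<in> I \<Longrightarrow> e \<le> y \<Longrightarrow> y < top \<Longrightarrow> U x y = x"
    "x < e \<Longrightarrow> y \<in> I \<Longrightarrow> U x y = y" "e \<le> x \<Longrightarrow> x < top \<Longrightarrow> y \<in> I \<Longrightarrow> U x y = y"
    by (auto simp: U1_def Let_def I_iff)
  show "U x top = top" "U top x = top"
    using e_top top_unique[of e]
    by (cases x rule: region_cases; auto simp: U1_def Let_def I_iff S_top less_le; fail)+
qed

lemma S_less_top_if_uninorm:
  assumes "uninorm e U" and x: "e \<le> x" "x < top" and y: "e \<le> y" "y < top"
  shows "S x y < top"
proof (rule ccontr)
  assume "\<not> S x y < top"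
  then have "S x y = top" by (simp add: less_le)
  have bot: "bot < e" using e_bot by (simp add: bot.not_eq_extremum)
  have assoc: "\<forall>x y z. U (U x y) z = U x (U y z)"
    using assms(1) unfolding uninorm_def comm_assoc_increasing_on_def ball_UNIV by (elim conjE)
  \<comment> \<open>Grouped this way, \<open>U x y = top\<close> absorbs \<open>bot\<close>; grouped
    the other way, \<open>y\<close> and then \<open>x\<close>, both in \<open>[e,1[\<close>, leave
    \<open>bot\<close> unchanged.\<close>
  have "top = U (U x y) bot"
    using x y \<open>S x y = top\<close> by (simp add: U1_simps)
  also have "\<dots> = U x (U y bot)"
    by (simp add: assoc)
  also have "\<dots> = bot"
    using x y bot by (simp add: U1_simps)
  finally show False
    using bot by (metis bot.extremum_unique top_greatest less_le)
qed

lemma uninorm_if_S_less_top: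
  assumes I: "\<And>x y. x \<in> I \<Longrightarrow> e \<le> y \<Longrightarrow> y < top \<Longrightarrow> incomparable x y"
    and S_less: "\<And>x y. e \<le> x \<Longrightarrow> x < top \<Longrightarrow> e \<le> y \<Longrightarrow> y < top \<Longrightarrow> S x y < top"
  shows "uninorm e U"
proof -
  \<comment> \<open>The join is not below \<open>e\<close>, since \<open>x\<close> is not. In
    \<open>[e,1[\<close> it would be incomparable to \<open>x\<close> by hypothesis, yet it is above
    \<open>x\<close>.\<close>
  have sup_I: "sup x y \<in> I \<or> sup x y = top" if "x \<in> I" "y \<in> I" for x y
    using that I[OF that(1), of "sup x y"] le_supE[of x y e]
    by (auto simp: I_iff incomparable_def less_le)
  have e: "e < top" using e_top by (simp add: less_le)
  have neutral: "U e x = x" for x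
    using e by (cases x rule: region_cases) (simp_all add: U1_simps S_e)
  have comm: "U x y = U y x" for x y
    by (cases x rule: region_cases; cases y rule: region_cases)
      (simp_all add: U1_simps T_comm S_comm sup_commute)
  \<comment> \<open>If an inner join leaves \<open>I\<close>, it is \<open>top\<close>, and then
    both sides are \<open>top\<close>.\<close>
  have I_assoc: "U (sup x y) z = U x (sup y z)" if "x \<in> I" "y \<in> I" "z \<in> I" for x y z
    using that sup_I[of x y] sup_I[of y z]
    by (auto simp: U1_simps sup_assoc; metis sup_assoc sup_top_left)
  have I_sup: "U (sup x y) z = sup x y" "U z (sup x y) = sup x y"
    if "x \<in> I" "y \<in> I" "z < e \<or> e \<le> z \<and> z < top" for x y z
    using that sup_I[of x y] by (auto simp: U1_simps)
  have assoc: "U (U x y) z = U x (U y z)" for x y z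
    by (cases x rule: region_cases; cases y rule: region_cases; cases z rule: region_cases)
      (simp_all add: U1_simps T_less S_less T_closed S_closed T_assoc S_assoc I_sup I_assoc)
  have mono: "U x y \<le> U x' y" if "x \<le> x'" for x x' y
  proof (cases "x' = top")
    case True
    then show ?thesis by (simp add: U1_simps)
  next
    case False
    \<comment> \<open>Here \<open>x'\<close> lies in \<open>[e,1[\<close>, so by hypothesis no
      element of \<open>I\<close> is below it.\<close>
    have x_le_e: "x \<le> e" if "e \<le> x'" "\<not> e \<le> x"
      using I[of x x'] that False \<open>x \<le> x'\<close> by (auto simp: I_iff incomparable_def less_le)
    \<comment> \<open>Two changes of region need a chain: \<open>T x y\<close> \<le>
      \<open>x\<close> \<le> \<open>x'\<close> for \<open>x, y < e\<close> and \<open>x'\<close> in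
      \<open>I\<close>, and \<open>x\<close> \<le> \<open>x'\<close> \<le> \<open>S x' y\<close> for
      \<open>x < e\<close> and \<open>x', y\<close> in \<open>[e,1[\<close>.\<close>
    from False \<open>x \<le> x'\<close> show ?thesis
      by (cases x rule: region_cases; cases x' rule: region_cases; cases y rule: region_cases)
        (auto simp: U1_simps T_mono S_mono T_le top_unique I_iff le_supI1 dest: x_le_e
          intro: order_trans[OF T_le(1)] order_trans[OF _ S_ge(1)])
  qed
  have mono': "U x y \<le> U x y'" if "y \<le> y'" for x y y'
    using mono[OF that] by (simp add: comm[of x])
  show ?thesis
    unfolding uninorm_def comm_assoc_increasing_on_def
    by (auto simp: assoc neutral intro: comm mono mono')
qed

end

text \<open>Conjugation by the order-reversing bijection \<open>dual\<close>: it exchanges t-norms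
  and t-conorms and preserves uninorms.\<close>

definition dual_op :: "('a \<Rightarrow> 'a \<Rightarrow> 'a) \<Rightarrow> 'a dual \<Rightarrow> 'a dual \<Rightarrow> 'a dual" where
  "dual_op F x y = dual (F (undual x) (undual y))"

lemma dual_op_dual [simp]: "dual_op F (dual x) (dual y) = dual (F x y)"
  by (simp add: dual_op_def)

lemma dual_image_Icc: "dual ` {a..b} = {dual b..dual a}"
  for a b :: "'a::order"
proof -
  have "z \<in> dual ` A \<longleftrightarrow> undual z \<in> A" for z and A :: "'a set"
    by (metis dual_undual inj_dual inj_image_mem_iff)
  then show ?thesis
    by (auto simp: dual_less_eq_iff)
qed

text \<open>The axioms are self-dual: reversing both inequalities in monotonicity only renames the
  two compared variables.\<close>

lemma comm_assoc_increasing_on_dual: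
  "comm_assoc_increasing_on (dual ` A) (dual_op F) \<longleftrightarrow> comm_assoc_increasing_on A F"
  unfolding comm_assoc_increasing_on_def
  by (simp add: inj_image_mem_iff[OF inj_dual]) (intro arg_cong2[where f = "(\<and>)"] refl; blast)

lemma tnorm_on_dual: "tconorm_on a b F \<Longrightarrow> tnorm_on (dual b) (dual a) (dual_op F)"
  unfolding tnorm_on_def tconorm_on_def
  by (simp add: dual_image_Icc[symmetric] comm_assoc_increasing_on_dual)

lemma tconorm_on_dual: "tnorm_on a b F \<Longrightarrow> tconorm_on (dual b) (dual a) (dual_op F)"
  unfolding tnorm_on_def tconorm_on_def
  by (simp add: dual_image_Icc[symmetric] comm_assoc_increasing_on_dual)

lemma uninorm_dual: "uninorm (dual e) (dual_op F) \<longleftrightarrow> uninorm e F"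
proof -
  have "(\<forall>x. dual_op F (dual e) x = x) \<longleftrightarrow> (\<forall>x. dual_op F (dual e) (dual x) = dual x)"
    by (metis dual_undual)
  then show ?thesis
    using comm_assoc_increasing_on_dual[of UNIV F] by (simp add: uninorm_def surj_dual)
qed

lemma incomparable_dual [simp]: "incomparable (dual x) (dual y) \<longleftrightarrow> incomparable x y"
  by (auto simp: incomparable_def)

lemma incomparables_dual [simp]: "dual x \<in> incomparables (dual e) \<longleftrightarrow> x \<in> incomparables e"
  by (simp add: incomparables_def)

context norm_pair
begin

lemma norm_pair_dual: "norm_pair (dual e) (dual_op S) (dual_op T)"
  using e_bot e_top tnorm_on_dual[OF tconorm] tconorm_on_dual[OF tnorm]
  by (simp add: norm_pair_def flip: dual_bot_eq dual_top_eq)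

text \<open>Order reversal exchanges \<open>[0,e]\<close> with \<open>[e,1]\<close> and meet with
  join, and preserves incomparability to \<open>e\<close>, so the branches correspond.\<close>

lemma U2_dual: "dual_op (U2 e T S) = U1 (dual e) (dual_op S) (dual_op T)"
proof (intro ext)
  fix x y :: "'a dual"
  obtain x' y' where [simp]: "x = dual x'" "y = dual y'"
    by (metis dual_undual)
  \<comment> \<open>The two sides test the squares \<open>[0,e]\<close> and \<open>[e,1]\<close> in
    opposite orders, which is harmless because \<open>T\<close> and \<open>S\<close> agree on the
    overlap \<open>(e,e)\<close>.\<close>
  have "T x' y' = S x' y'" if "x' \<le> e" "y' \<le> e" "e \<le> x'" "e \<le> y'"
  proof -
    have "x' = e" "y' = e" using that by simp_all
    then show ?thesis by (simp add: T_e S_e)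
  qed
  then show "dual_op (U2 e T S) x y = U1 (dual e) (dual_op S) (dual_op T) x y"
    unfolding U1_def U2_def Let_def
    by (cases "x' \<le> e \<and> y' \<le> e"; cases "e \<le> x' \<and> e \<le> y'")
      (simp_all add: if_distrib[of dual] flip: dual_bot_eq dual_top_eq
        add: ac_simps cong: if_cong del: de_Morgan_conj split del: if_split)
qed

lemma U1_uninorm_iff:
  assumes "\<forall>x\<in>incomparables e. \<forall>y\<in>{e..<top}. incomparable x y"
  shows "uninorm e (U1 e T S) \<longleftrightarrow>
    (\<forall>x\<in>{e..top}. \<forall>y\<in>{e..top}. x < top \<and> y < top \<longrightarrow> S x y < top)"
  using S_less_top_if_uninorm uninorm_if_S_less_top assms by auto

lemma U2_uninorm_iff:
  assumes "\<forall>x\<in>incomparables e. \<forall>y\<in>{bot<..e}. incomparable x y"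
  shows "uninorm e (U2 e T S) \<longleftrightarrow>
    (\<forall>x\<in>{bot..e}. \<forall>y\<in>{bot..e}. bot < x \<and> bot < y \<longrightarrow> bot < T x y)"
proof -
  interpret dual: norm_pair "dual e" "dual_op S" "dual_op T"
    by (rule norm_pair_dual)
  have all_dual: "(\<forall>x. P x) \<longleftrightarrow> (\<forall>x. P (dual x))" for P :: "'a dual \<Rightarrow> bool"
    by (metis dual_undual)
  \<comment> \<open>The interval \<open>[dual e, top[\<close> is the image of \<open>]0,e]\<close>,
    so the assumption becomes the hypothesis of part (i).\<close>
  have "\<forall>x\<in>incomparables (dual e). \<forall>y\<in>{dual e..<top}. incomparable x y"
    using assms by (simp add: Ball_def all_dual flip: dual_bot_eq)
  from dual.U1_uninorm_iff[OF this] show ?thesis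
    by (simp add: Ball_def all_dual uninorm_dual flip: U2_dual dual_bot_eq)
qed

end

theorem theorem3p1:
  fixes e :: "'a::bounded_lattice"
    and T S :: "'a \<Rightarrow> 'a \<Rightarrow> 'a"
  assumes e: "e \<noteq> bot" "e \<noteq> top"
    and T: "tnorm_on bot e T"
    and S: "tconorm_on e top S"
  shows
    "((\<forall>x\<in>incomparables e. \<forall>y\<in>{e..<top}. incomparable x y) \<longrightarrow>
        (uninorm e (U1 e T S) \<longleftrightarrow>
           (\<forall>x\<in>{e..top}. \<forall>y\<in>{e..top}. x < top \<and> y < top \<longrightarrow> S x y < top))) \<and>
     ((\<forall>x\<in>incomparables e. \<forall>y\<in>{bot<..e}. incomparable x y) \<longrightarrow>
        (uninorm e (U2 e T S) \<longleftrightarrow>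
           (\<forall>x\<in>{bot..e}. \<forall>y\<in>{bot..e}. bot < x \<and> bot < y \<longrightarrow> bot < T x y)))"
proof -
  interpret norm_pair e T S
    using e T S by unfold_locales
  show ?thesis
    by (intro conjI impI U1_uninorm_iff U2_uninorm_iff)
qed

end
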